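(* There exist a probability space, a sequence $(X_n)_{n\in\mathbb{N}}$ of independent real random variables on it such that each $X_n$ takes exactly two values (each with positive probability), $E(X_n)=0$ and $E(X_n^2)=1$, and functions $f_{n,1}\in\mathcal{F}_1$, $f_{n,2}\in\mathcal{F}_2$ ($n\in\mathbb{N}$), such that the random variables $$F_n = Q_1(f_{n,1})+Q_2(f_{n,2})$$ satisfy $F_n\to 0$ almost surely and $F_n\to 0$ in $L_2$ as $n\to\infty$, but $Q_1(f_{n,1})$ does not converge to $0$ almost surely.
   Context: For $p\in\mathbb{N}=\{1,2,\dots\}$, $\mathcal{F}_p$ denotes the set of functions $f:\mathbb{N}^p\to\mathbb{R}$ such that $f$ is symmetric (invariant under permutations of its arguments), $f$ vanishes on the diagonal ($f(j_1,\dots,j_p)=0$ whenever $j_r=j_s$ for some $r\neq s$), and $\sum_{j_1,\dots,j_p\in\mathbb{N}} f(j_1,\dots,j_p)^2<\infty$. Given independent real random variables $(X_n)_{n\in\mathbb{N}}$ with $E(X_n)=0$ and $E(X_n^2)=1$, and $f\in\mathcal{F}_p$, put $$Q_p(f)=\sum_{j_1,\dots,j_p\in\mathbb{N}} f(j_1,\dots,j_p)\,X_{j_1}\cdots X_{j_p},$$ meaning the limit, almost surely and in $L_2$, as $n\to\infty$ of the partial sums over $j_1,\dots,j_p\in\{1,\dots,n\}$ (the limit exists by the martingale convergence theorem). *)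

theory Defs
  imports
    "HOL-Probability.Probability"
    "HOL-Combinatorics.Permutations"
    "HOL-Library.NList"
begin

text \<open>
  The index set is \<open>{1..}\<close>, and a multi-index \<open>(j\<^sub>1, \<dots>, j\<^sub>p)\<close> is a list in \<open>nlists p {1..}\<close>.
  Kernels are functions on all lists; only their values on \<open>nlists p {1..}\<close> matter.
\<close>

definition kernels :: "nat \<Rightarrow> (nat list \<Rightarrow> real) set" where
  "kernels p = {f.
     (\<forall>js \<in> nlists p {1..}. \<forall>\<pi>. \<pi> permutes {..<p} \<longrightarrow> f (permute_list \<pi> js) = f js) \<and>
     (\<forall>js \<in> nlists p {1..}. \<not> distinct js \<longrightarrow> f js = 0) \<and>
     (\<lambda>js. (f js)\<^sup>2) summable_on nlists p {1..}}"

definition chaos_sum ::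
  "(nat \<Rightarrow> 'a \<Rightarrow> real) \<Rightarrow> nat \<Rightarrow> (nat list \<Rightarrow> real) \<Rightarrow> nat \<Rightarrow> 'a \<Rightarrow> real" where
  "chaos_sum X p f n \<omega> = (\<Sum>js \<in> nlists p {1..n}. f js * (\<Prod>j\<leftarrow>js. X j \<omega>))"

text \<open>Sequences of random variables are indexed by \<open>{1..}\<close>; a term with index \<open>0\<close> is ignored.\<close>

definition tendsto_L2 :: "'a measure \<Rightarrow> (nat \<Rightarrow> 'a \<Rightarrow> real) \<Rightarrow> ('a \<Rightarrow> real) \<Rightarrow> bool" where
  "tendsto_L2 M F G \<longleftrightarrow>
     (\<forall>n\<ge>1. F n \<in> borel_measurable M \<and> integrable M (\<lambda>\<omega>. (F n \<omega>)\<^sup>2)) \<and>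
     G \<in> borel_measurable M \<and> integrable M (\<lambda>\<omega>. (G \<omega>)\<^sup>2) \<and>
     (\<lambda>n. LINT \<omega>|M. (F n \<omega> - G \<omega>)\<^sup>2) \<longlonglongrightarrow> 0"

definition tendsto_AE :: "'a measure \<Rightarrow> (nat \<Rightarrow> 'a \<Rightarrow> real) \<Rightarrow> ('a \<Rightarrow> real) \<Rightarrow> bool" where
  "tendsto_AE M F G \<longleftrightarrow> (AE \<omega> in M. (\<lambda>n. F n \<omega>) \<longlonglongrightarrow> G \<omega>)"

text \<open>
  \<open>Q\<^sub>p(f)\<close> is only determined up to almost sure equality, hence a predicate:
  \<open>is_chaos M X p f Q\<close> says that \<open>Q\<close> is a version of \<open>Q\<^sub>p(f)\<close>.
\<close>

definition is_chaos ::
  "'a measure \<Rightarrow> (nat \<Rightarrow> 'a \<Rightarrow> real) \<Rightarrow> nat \<Rightarrow> (nat list \<Rightarrow> real) \<Rightarrow> ('a \<Rightarrow> real) \<Rightarrow> bool" where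
  "is_chaos M X p f Q \<longleftrightarrow> tendsto_AE M (chaos_sum X p f) Q \<and> tendsto_L2 M (chaos_sum X p f) Q"

end

theory Submission
  imports Defs "HOL-Combinatorics.Multiset_Permutations" "HOL-Library.Discrete_Functions"
    "HOL-Real_Asymp.Real_Asymp"
begin

text \<open>
  Let \<open>X\<^sub>j\<close> take the value \<open>s\<^sub>j\<close> with probability \<open>1 / (1 + s\<^sub>j\<^sup>2)\<close> and \<open>-1/s\<^sub>j\<close> otherwise, where
  \<open>s\<^sub>2\<^sub>k = k\<close> and \<open>s\<^sub>2\<^sub>n\<^sub>+\<^sub>1 = sqrt (n + 1)\<close>. Put \<open>F\<^sub>n = X\<^sub>2\<^sub>n\<^sub>+\<^sub>1 (1 + k X\<^sub>2\<^sub>k) / sqrt (n + 1)\<close> with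
  \<open>k = k(n)\<close> tending to infinity so slowly that \<open>E F\<^sub>n\<^sup>2 = (1 + k\<^sup>2) / (n + 1)\<close> tends to 0. The
  probabilities \<open>1 / (1 + k\<^sup>2)\<close> are summable, so by Borel-Cantelli almost surely \<open>X\<^sub>2\<^sub>k = -1/k\<close> for
  large \<open>k\<close>, and then \<open>F\<^sub>n = 0\<close> for large \<open>n\<close>. The probabilities \<open>1 / (n + 2)\<close> are not summable, so
  almost surely the first-order part \<open>X\<^sub>2\<^sub>n\<^sub>+\<^sub>1 / sqrt (n + 1)\<close> equals 1 infinitely often.
\<close>

section \<open>Kernels of monomials\<close>

text \<open>The coefficient is spread evenly over all orderings of \<open>ks\<close>. This makes the
  kernel symmetric, while the orderings together still contribute \<open>c\<close> times the
  monomial.\<close>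

definition monomial_kernel :: "real \<Rightarrow> nat list \<Rightarrow> nat list \<Rightarrow> real" where
  "monomial_kernel c ks js =
     (if js \<in> permutations_of_set (set ks) then c / fact (length ks) else 0)"

lemma monomial_kernel_in_kernels:
  assumes "distinct ks"
  shows "monomial_kernel c ks \<in> kernels (length ks)"
proof -
  let ?f = "monomial_kernel c ks" and ?P = "permutations_of_set (set ks)"
  have sym: "?f (permute_list \<pi> js) = ?f js"
    if "js \<in> nlists (length ks) {1..}" "\<pi> permutes {..<length ks}" for js \<pi>
    using that by (simp add: monomial_kernel_def permutations_of_set_def)
  have diag: "?f js = 0" if "\<not> distinct js" for js
    using that by (simp add: monomial_kernel_def permutations_of_set_def)
  \<comment> \<open>Square summability is trivial, because the support consists of finitely many
    orderings.\<close>
  have "(\<lambda>js. (?f js)\<^sup>2) summable_on ?P \<inter> nlists (length ks) {1..}"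
    by (intro summable_on_finite) auto
  then have "(\<lambda>js. (?f js)\<^sup>2) summable_on nlists (length ks) {1..}"
    by (rule summable_on_cong_neutral[THEN iffD1, rotated -1]) (auto simp: monomial_kernel_def)
  with sym diag show ?thesis
    by (simp add: kernels_def)
qed

lemma finite_nlists: "finite A \<Longrightarrow> finite (nlists n A)"
  unfolding nlists_def conj_commute[of "length _ = _"] by (rule finite_lists_length_eq)

text \<open>All \<open>fact (length ks)\<close> orderings give the same product of variables, which
  cancels the factorial in the kernel.\<close>

lemma chaos_sum_monomial_kernel:
  assumes "distinct ks"
  shows "chaos_sum X (length ks) (monomial_kernel c ks) n \<omega> =
           (if set ks \<subseteq> {1..n} then c * (\<Prod>k\<in>set ks. X k \<omega>) else 0)"
proof -
  let ?P = "permutations_of_set (set ks)"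
  \<comment> \<open>Membership of an ordering depends only on its set of entries, so either all
    orderings are summed or none.\<close>
  have P: "?P \<inter> nlists (length ks) {1..n} = (if set ks \<subseteq> {1..n} then ?P else {})"
  proof -
    have "js \<in> nlists (length ks) {1..n} \<longleftrightarrow> set ks \<subseteq> {1..n}" if "js \<in> ?P" for js
    proof -
      have "set js = set ks" and "distinct js"
        using that by (rule permutations_of_setD)+
      with assms have "length js = length ks" by (metis distinct_card)
      with \<open>set js = set ks\<close> show ?thesis by (simp only: nlists_def mem_Collect_eq simp_thms)
    qed
    then show ?thesis by (simp only: set_eq_iff Int_iff split: if_splits) blast
  qed
  have "chaos_sum X (length ks) (monomial_kernel c ks) n \<omega> =
      (\<Sum>js \<in> ?P \<inter> nlists (length ks) {1..n}. c / fact (length ks) * (\<Prod>j\<leftarrow>js. X j \<omega>))"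
    unfolding chaos_sum_def
    by (rule sum.mono_neutral_cong_right) (auto simp: finite_nlists monomial_kernel_def)
  also have "\<dots> = (\<Sum>js \<in> ?P \<inter> nlists (length ks) {1..n}.
      c / fact (length ks) * (\<Prod>k\<in>set ks. X k \<omega>))"
    by (intro sum.cong refl)
       (metis IntD1 permutations_of_setD prod.distinct_set_conv_list)
  also have "\<dots> = (if set ks \<subseteq> {1..n} then c * (\<Prod>k\<in>set ks. X k \<omega>) else 0)"
    unfolding P using assms by (simp add: distinct_card)
  finally show ?thesis .
qed

text \<open>The partial sums are 0 until every index of the monomial is available and equal the
  monomial from then on, so both modes of convergence hold for an eventually constant
  sequence.\<close>

lemma is_chaos_monomial_kernel:
  assumes "distinct ks" and "0 \<notin> set ks"
    and meas: "(\<lambda>\<omega>. c * (\<Prod>k\<in>set ks. X k \<omega>)) \<in> borel_measurable M"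
    and int: "integrable M (\<lambda>\<omega>. (c * (\<Prod>k\<in>set ks. X k \<omega>))\<^sup>2)"
  shows "is_chaos M X (length ks) (monomial_kernel c ks) (\<lambda>\<omega>. c * (\<Prod>k\<in>set ks. X k \<omega>))"
proof -
  let ?Q = "\<lambda>\<omega>. c * (\<Prod>k\<in>set ks. X k \<omega>)"
  let ?S = "chaos_sum X (length ks) (monomial_kernel c ks)"
  note S = chaos_sum_monomial_kernel[OF assms(1)]
  \<comment> \<open>The sum of the entries serves as a convenient upper bound for each of
    them.\<close>
  have "set ks \<subseteq> {1..n}" if "n \<ge> sum_list ks" for n
  proof
    fix k assume k: "k \<in> set ks"
    then have "k \<le> sum_list ks" by (simp add: member_le_sum_list)
    moreover have "k \<noteq> 0" using k assms(2) by metis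
    ultimately show "k \<in> {1..n}" using that by simp
  qed
  then have S_eq: "?S n \<omega> = ?Q \<omega>" if "n \<ge> sum_list ks" for n \<omega>
    using that by (simp add: S)
  have "(\<lambda>n. ?S n \<omega>) \<longlonglongrightarrow> ?Q \<omega>" for \<omega>
    by (rule tendsto_eventually, rule eventually_sequentiallyI, rule S_eq)
  moreover have "(\<lambda>n. LINT \<omega>|M. (?S n \<omega> - ?Q \<omega>)\<^sup>2) \<longlonglongrightarrow> 0"
    by (rule tendsto_eventually, rule eventually_sequentiallyI[of "sum_list ks"])
       (simp add: S_eq)
  moreover have "?S n \<in> borel_measurable M \<and> integrable M (\<lambda>\<omega>. (?S n \<omega>)\<^sup>2)" for n
    using meas int by (cases "set ks \<subseteq> {1..n}") (simp_all add: S cong: measurable_cong)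
  ultimately show ?thesis
    using meas int by (simp add: is_chaos_def tendsto_AE_def tendsto_L2_def)
qed

section \<open>Independent standardized two-valued variables\<close>

text \<open>For the values \<open>s\<close> and \<open>-1/s\<close>, mean 0 forces the probability
  \<open>1 / (1 + s\<^sup>2)\<close> of the value \<open>s\<close>; the second moment is then
  automatically 1. The outcomes are coded as the reals 1 and 0.\<close>

definition coin :: "real \<Rightarrow> real pmf" where
  "coin s = map_pmf of_bool (bernoulli_pmf (1 / (1 + s\<^sup>2)))"

definition coins :: "(nat \<Rightarrow> real) \<Rightarrow> (nat \<Rightarrow> real) measure" where
  "coins s = PiM UNIV (\<lambda>j. measure_pmf (coin (s j)))"

text \<open>Every coordinate other than 1 is sent to the low value, so exactly two values occur on
  the whole space and not just almost surely.\<close>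

definition two_point :: "(nat \<Rightarrow> real) \<Rightarrow> nat \<Rightarrow> (nat \<Rightarrow> real) \<Rightarrow> real" where
  "two_point s j \<omega> = (if \<omega> j = 1 then s j else - (1 / s j))"

lemma prob_space_coins: "prob_space (coins s)"
  unfolding coins_def by (intro prob_space_PiM measure_pmf.prob_space_axioms)

lemma space_coins [simp]: "space (coins s) = UNIV"
  by (simp add: coins_def space_PiM)

lemma measurable_coin [measurable]: "(\<lambda>\<omega>. \<omega> j) \<in> coins s \<rightarrow>\<^sub>M count_space UNIV"
proof -
  have "(\<lambda>\<omega>. \<omega> j) \<in> coins s \<rightarrow>\<^sub>M measure_pmf (coin (s j))"
    unfolding coins_def by (rule measurable_component_singleton) simp
  then show ?thesis
    by (simp cong: measurable_cong_sets)
qed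

lemma measurable_two_point [measurable]: "two_point s j \<in> borel_measurable (coins s)"
  unfolding two_point_def by measurable

lemma distr_coins: "distr (coins s) (measure_pmf (coin (s j))) (\<lambda>\<omega>. \<omega> j) = measure_pmf (coin (s j))"
  unfolding coins_def by (intro distr_PiM_component measure_pmf.prob_space_axioms) simp

text \<open>Each coordinate is a discrete space with a Bernoulli law, so the integral is a two-term
  sum for arbitrary \<open>h\<close>.\<close>

lemma integral_two_point:
  fixes h :: "real \<Rightarrow> real"
  shows "(LINT \<omega>|coins s. h (two_point s j \<omega>)) =
           h (s j) * (1 / (1 + (s j)\<^sup>2)) + h (- (1 / s j)) * (1 - 1 / (1 + (s j)\<^sup>2))"
proof -
  let ?g = "\<lambda>x. h (if x = 1 then s j else - (1 / s j))"
  have [measurable]: "(\<lambda>\<omega>. \<omega> j) \<in> coins s \<rightarrow>\<^sub>M measure_pmf (coin (s j))"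
    using measurable_coin by (simp cong: measurable_cong_sets)
  have "(LINT \<omega>|coins s. h (two_point s j \<omega>)) =
      integral\<^sup>L (distr (coins s) (measure_pmf (coin (s j))) (\<lambda>\<omega>. \<omega> j)) ?g"
    by (subst integral_distr) (auto simp: two_point_def)
  also have "\<dots> =
      measure_pmf.expectation (bernoulli_pmf (1 / (1 + (s j)\<^sup>2))) (\<lambda>b. ?g (of_bool b :: real))"
    unfolding distr_coins by (simp add: coin_def)
  also have "\<dots> = h (s j) * (1 / (1 + (s j)\<^sup>2)) + h (- (1 / s j)) * (1 - 1 / (1 + (s j)\<^sup>2))"
    by (subst integral_bernoulli_pmf) (auto simp: divide_le_eq add_pos_nonneg)
  finally show ?thesis .
qed

lemma integrable_two_point:
  "integrable (coins s) (\<lambda>\<omega>. h (two_point s j \<omega>) :: real)"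
proof -
  interpret prob_space "coins s" by (rule prob_space_coins)
  have [measurable]: "(\<lambda>\<omega>. h (two_point s j \<omega>)) \<in> borel_measurable (coins s)"
    unfolding two_point_def by measurable
  show ?thesis
    by (rule integrable_const_bound[where B = "\<bar>h (s j)\<bar> + \<bar>h (- (1 / s j))\<bar>"])
       (auto simp: two_point_def)
qed

lemma two_point_mean: "s j > 0 \<Longrightarrow> (LINT \<omega>|coins s. two_point s j \<omega>) = 0"
proof -
  assume "s j > 0"
  moreover have "1 + (s j)\<^sup>2 > 0" by (simp add: add_pos_nonneg)
  ultimately show ?thesis
    unfolding integral_two_point[of s "\<lambda>x. x" j] by (simp add: divide_simps) (simp add: power2_eq_square)
qed

lemma two_point_variance: "s j > 0 \<Longrightarrow> (LINT \<omega>|coins s. (two_point s j \<omega>)\<^sup>2) = 1"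
proof -
  assume "s j > 0"
  moreover have "1 + (s j)\<^sup>2 > 0" by (simp add: add_pos_nonneg)
  ultimately show ?thesis
    using integral_two_point[of s "\<lambda>x. x\<^sup>2" j] by (simp add: field_simps)
qed

lemma prob_two_point:
  assumes "s j > 0"
  shows "measure (coins s) {\<omega>. two_point s j \<omega> = s j} = 1 / (1 + (s j)\<^sup>2)"
    and "measure (coins s) {\<omega>. two_point s j \<omega> = - (1 / s j)} = 1 - 1 / (1 + (s j)\<^sup>2)"
proof -
  have "- (1 / s j) < 0" using assms by simp
  with assms have ne: "s j \<noteq> - (1 / s j)" by linarith
  \<comment> \<open>A probability is rewritten as the expectation of a function of the variable, to
    which \<open>integral_two_point\<close> applies.\<close>
  have ind: "measure (coins s) {\<omega>. two_point s j \<omega> = a} =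
      (LINT \<omega>|coins s. indicator {a} (two_point s j \<omega>))" for a
  proof -
    have "measure (coins s) {\<omega>. two_point s j \<omega> = a} =
        (LINT \<omega>|coins s. indicator {\<omega>. two_point s j \<omega> = a} \<omega>)"
      by simp
    also have "\<dots> = (LINT \<omega>|coins s. indicator {a} (two_point s j \<omega>))"
      by (intro Bochner_Integration.integral_cong) (auto simp: indicator_def)
    finally show ?thesis .
  qed
  show "measure (coins s) {\<omega>. two_point s j \<omega> = s j} = 1 / (1 + (s j)\<^sup>2)"
    using ne ne[symmetric] unfolding ind integral_two_point by simp
  show "measure (coins s) {\<omega>. two_point s j \<omega> = - (1 / s j)} = 1 - 1 / (1 + (s j)\<^sup>2)"
    using ne ne[symmetric] unfolding ind integral_two_point by simp
qed

lemma range_two_point: "range (two_point s j) = {s j, - (1 / s j)}"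
proof (rule subset_antisym)
  show "range (two_point s j) \<subseteq> {s j, - (1 / s j)}"
    by (simp add: image_subset_iff two_point_def)
  have "two_point s j (\<lambda>_. 1) \<in> range (two_point s j)" "two_point s j (\<lambda>_. 0) \<in> range (two_point s j)"
    by (rule rangeI)+
  then show "{s j, - (1 / s j)} \<subseteq> range (two_point s j)"
    by (simp add: two_point_def[of s j "\<lambda>_. 1"] two_point_def[of s j "\<lambda>_. 0"])
qed

lemma two_point_two_valued:
  assumes "s j > 0"
  shows "\<exists>a b. a \<noteq> b \<and> two_point s j ` space (coins s) = {a, b} \<and>
    measure (coins s) {\<omega> \<in> space (coins s). two_point s j \<omega> = a} > 0 \<and>
    measure (coins s) {\<omega> \<in> space (coins s). two_point s j \<omega> = b} > 0"
proof (rule exI[of _ "s j"], rule exI[of _ "- (1 / s j)"], intro conjI)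
  have "- (1 / s j) < 0" using assms by simp
  with assms show "s j \<noteq> - (1 / s j)" by linarith
  show "two_point s j ` space (coins s) = {s j, - (1 / s j)}"
    unfolding space_coins by (rule range_two_point)
  have gt: "1 + (s j)\<^sup>2 > 1" using assms by simp
  have "1 / (1 + (s j)\<^sup>2) > 0"
    by (rule divide_pos_pos) (use gt in linarith)+
  then show "measure (coins s) {\<omega> \<in> space (coins s). two_point s j \<omega> = s j} > 0"
    using prob_two_point(1)[of s j, OF assms] by simp
  have "1 / (1 + (s j)\<^sup>2) < 1"
    using gt by (subst divide_less_eq_1_pos) linarith+
  then show "measure (coins s) {\<omega> \<in> space (coins s). two_point s j \<omega> = - (1 / s j)} > 0"
    using prob_two_point(2)[of s j, OF assms] by simp
qed

text \<open>Independence means that the joint law of the coordinates is the product of their laws.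
  Here the joint map is the identity on a product measure.\<close>

lemma indep_vars_coins:
  "prob_space.indep_vars (coins s) (\<lambda>j. measure_pmf (coin (s j))) (\<lambda>j \<omega>. \<omega> j) UNIV"
proof -
  interpret prob_space "coins s" by (rule prob_space_coins)
  have [measurable]: "(\<lambda>\<omega>. \<omega> j) \<in> coins s \<rightarrow>\<^sub>M measure_pmf (coin (s j))" for j
    using measurable_coin by (simp cong: measurable_cong_sets)
  have "distr (coins s) (coins s) (\<lambda>\<omega>. \<omega>) = coins s"
    by (rule distr_id2) simp
  then show ?thesis
    by (subst indep_vars_iff_distr_eq_PiM')
       (auto simp: distr_coins restrict_UNIV coins_def[symmetric])
qed

lemma indep_vars_two_point:
  "prob_space.indep_vars (coins s) (\<lambda>_. borel) (two_point s) I"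
proof -
  interpret prob_space "coins s" by (rule prob_space_coins)
  have "indep_vars (\<lambda>_. borel) (\<lambda>j \<omega>. two_point s j \<omega>) UNIV"
    unfolding two_point_def
    by (rule indep_vars_compose2[OF indep_vars_coins, where Y = "\<lambda>j x. if x = 1 then s j else - (1 / s j)"])
       simp
  then show ?thesis
    by (rule indep_vars_subset) simp
qed

lemma product_moment:
  fixes g h :: "real \<Rightarrow> real"
  assumes [measurable]: "g \<in> borel_measurable borel" "h \<in> borel_measurable borel" and "i \<noteq> j"
  shows "integrable (coins s) (\<lambda>\<omega>. g (two_point s i \<omega>) * h (two_point s j \<omega>))"
    and "(LINT \<omega>|coins s. g (two_point s i \<omega>) * h (two_point s j \<omega>)) =
      (LINT \<omega>|coins s. g (two_point s i \<omega>)) * (LINT \<omega>|coins s. h (two_point s j \<omega>))"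
proof -
  interpret prob_space "coins s" by (rule prob_space_coins)
  \<comment> \<open>Choosing the function by index turns the two factors into one independent family
    over \<open>{i, j}\<close>; \<open>i \<noteq> j\<close> keeps \<open>g\<close> and
    \<open>h\<close> apart.\<close>
  let ?Y = "\<lambda>k x. if k = i then g x else h x"
  have "indep_vars (\<lambda>_. borel) (\<lambda>k \<omega>. ?Y k (two_point s k \<omega>)) {i, j}"
    by (rule indep_vars_compose2[OF indep_vars_two_point]) auto
  moreover have "integrable (coins s) (\<lambda>\<omega>. ?Y k (two_point s k \<omega>))" for k
    by (rule integrable_two_point)
  ultimately show "integrable (coins s) (\<lambda>\<omega>. g (two_point s i \<omega>) * h (two_point s j \<omega>))"
    and "(LINT \<omega>|coins s. g (two_point s i \<omega>) * h (two_point s j \<omega>)) =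
      (LINT \<omega>|coins s. g (two_point s i \<omega>)) * (LINT \<omega>|coins s. h (two_point s j \<omega>))"
    using indep_vars_integrable[of "{i, j}" "\<lambda>k \<omega>. ?Y k (two_point s k \<omega>)"]
      indep_vars_lebesgue_integral[of "{i, j}" "\<lambda>k \<omega>. ?Y k (two_point s k \<omega>)"] \<open>i \<noteq> j\<close>
    by auto
qed

section \<open>The counterexample\<close>

text \<open>\<open>amplitude 0 = 0\<close> makes the ignored variable with index 0 degenerate.\<close>
definition amplitude :: "nat \<Rightarrow> real" where
  "amplitude j = (if even j then real (j div 2) else sqrt (real (j div 2) + 1))"

lemma amplitude_even [simp]: "amplitude (2 * k) = real k"
  and amplitude_odd [simp]: "amplitude (Suc (2 * n)) = sqrt (real n + 1)"
  by (simp_all add: amplitude_def)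

lemma amplitude_pos: "j \<ge> 1 \<Longrightarrow> amplitude j > 0"
  by (auto simp: amplitude_def elim!: evenE)

abbreviation \<Omega> :: "(nat \<Rightarrow> real) measure" where "\<Omega> \<equiv> coins amplitude"
abbreviation X :: "nat \<Rightarrow> (nat \<Rightarrow> real) \<Rightarrow> real" where "X \<equiv> two_point amplitude"

section \<open>Almost sure behaviour of the even and the odd variables\<close>

lemma even_eventually_low:
  "AE \<omega> in \<Omega>. \<forall>\<^sub>F k in sequentially. X (2 * k) \<omega> = - (1 / real k)"
proof -
  interpret prob_space \<Omega> by (rule prob_space_coins)
  let ?A = "\<lambda>k. {\<omega> \<in> space \<Omega>. X (2 * k) \<omega> = real k}"
  have "summable (\<lambda>k. measure \<Omega> (?A k))"
  proof (rule summable_comparison_test_ev)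
    show "\<forall>\<^sub>F k in sequentially. norm (measure \<Omega> (?A k)) \<le> inverse (real k ^ 2)"
    \<comment> \<open>The comparison starts at 1: for \<open>k = 0\<close> the variable is
      constantly 0, so the event has probability 1, whereas \<open>inverse 0 = 0\<close>.\<close>
    proof (rule eventually_sequentiallyI)
      fix k :: nat assume "k \<ge> 1"
      then show "norm (measure \<Omega> (?A k)) \<le> inverse (real k ^ 2)"
        using prob_two_point(1)[of amplitude "2 * k"] by (simp add: inverse_eq_divide frac_le)
    qed
    show "summable (\<lambda>k. inverse (real k ^ 2))"
      by (rule inverse_power_summable) simp
  qed
  then have "AE \<omega> in \<Omega>. \<forall>\<^sub>F k in sequentially. \<omega> \<in> space \<Omega> - ?A k"
    by (intro borel_cantelli_AE1, measurable) (auto simp: less_top[symmetric])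
  then show ?thesis
  proof eventually_elim
    case (elim \<omega>)
    then show ?case
      by eventually_elim (auto simp: two_point_def split: if_splits)
  qed
qed

text \<open>By independence this is a product of factors
  \<open>1 - 1 / (n + 2) = (n + 1) / (n + 2)\<close>, which telescopes. It gives the divergence half
  of Borel-Cantelli in explicit form.\<close>

lemma prob_odd_low: "measure \<Omega> {\<omega>. \<forall>n\<in>{N..<N + m}. X (Suc (2 * n)) \<omega> \<noteq> sqrt (real n + 1)} =
    (real N + 1) / (real (N + m) + 1)"
\<comment> \<open>The product rule for independent events asks for a nonempty index set.\<close>
proof (cases "m = 0")
  case False
  interpret prob_space \<Omega> by (rule prob_space_coins)
  let ?J = "(\<lambda>n. Suc (2 * n)) ` {N..<N + m}"
  let ?B = "\<lambda>j. X j -` (- {amplitude j}) \<inter> space \<Omega>"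
  have "measure \<Omega> (\<Inter>j\<in>?J. ?B j) = (\<Prod>j\<in>?J. measure \<Omega> (?B j))"
    using False by (intro indep_varsD[OF indep_vars_two_point[of amplitude UNIV]]) auto
  also have "\<dots> = (\<Prod>n=N..<N + m. measure \<Omega> (?B (Suc (2 * n))))"
    by (subst prod.reindex) (auto simp: inj_on_def)
  also have "\<dots> = (\<Prod>n=N..<N + m. (real n + 1) / (real n + 2))"
  proof (intro prod.cong refl)
    fix n
    have "?B (Suc (2 * n)) = space \<Omega> - {\<omega>\<in>space \<Omega>. X (Suc (2 * n)) \<omega> = sqrt (real n + 1)}"
      by auto
    then have "measure \<Omega> (?B (Suc (2 * n))) =
        1 - measure \<Omega> {\<omega>\<in>space \<Omega>. X (Suc (2 * n)) \<omega> = sqrt (real n + 1)}"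
      by (simp only:) (rule prob_compl, measurable)
    also have "\<dots> = (real n + 1) / (real n + 2)"
      using prob_two_point(1)[of amplitude "Suc (2 * n)"] by (simp add: divide_simps) (simp add: algebra_simps)
    finally show "measure \<Omega> (?B (Suc (2 * n))) = (real n + 1) / (real n + 2)" .
  qed
  also have "\<dots> = (real N + 1) / (real (N + m) + 1)"
    by (induction m) (auto simp: field_simps)
  also have "(\<Inter>j\<in>?J. ?B j) =
      {\<omega>. \<forall>n\<in>{N..<N + m}. X (Suc (2 * n)) \<omega> \<noteq> sqrt (real n + 1)}"
    using False by auto
  finally show ?thesis .
next
  case True
  interpret prob_space \<Omega> by (rule prob_space_coins)
  from True show ?thesis using prob_space by simp
qed

text \<open>Staying low from \<open>N\<close> on implies staying low on every block
  \<open>{N..<N + m}\<close>, whose probability tends to 0 with \<open>m\<close>. The countably many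
  null sets, one for each \<open>N\<close>, are then combined.\<close>

lemma odd_not_eventually_low:
  "AE \<omega> in \<Omega>. \<not> (\<forall>\<^sub>F n in sequentially. X (Suc (2 * n)) \<omega> \<noteq> sqrt (real n + 1))"
proof -
  interpret prob_space \<Omega> by (rule prob_space_coins)
  have "AE \<omega> in \<Omega>. \<not> (\<forall>n\<ge>N. X (Suc (2 * n)) \<omega> \<noteq> sqrt (real n + 1))" for N
  proof -
    let ?B = "{\<omega> \<in> space \<Omega>. \<forall>n\<ge>N. X (Suc (2 * n)) \<omega> \<noteq> sqrt (real n + 1)}"
    have B: "?B \<in> sets \<Omega>" by measurable
    have "measure \<Omega> ?B \<le> (real N + 1) / (real (N + m) + 1)" for m
    proof -
      have "{\<omega> \<in> space \<Omega>. \<forall>n\<in>{N..<N + m}. X (Suc (2 * n)) \<omega> \<noteq> sqrt (real n + 1)} \<in> sets \<Omega>"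
        by measurable
      then show ?thesis
        unfolding prob_odd_low[symmetric] by (intro finite_measure_mono) auto
    qed
    moreover have "(\<lambda>m. (real N + 1) / (real (N + m) + 1)) \<longlonglongrightarrow> 0"
      by real_asymp
    ultimately have "measure \<Omega> ?B \<le> 0"
      by (intro LIMSEQ_le_const) auto
    then have "measure \<Omega> ?B = 0"
      by (simp add: measure_le_0_iff)
    with B have "AE \<omega> in \<Omega>. \<omega> \<notin> ?B"
      by (simp only: AE_iff_measurable[OF B] prob_eq_0)
    then show ?thesis by simp
  qed
  then have "AE \<omega> in \<Omega>. \<forall>N. \<not> (\<forall>n\<ge>N. X (Suc (2 * n)) \<omega> \<noteq> sqrt (real n + 1))"
    by (simp add: AE_all_countable)
  then show ?thesis
    by (simp add: eventually_sequentially)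
qed

text \<open>This is the integer part of the fourth root of \<open>n\<close>. With
  \<open>k = partner n\<close>, the square of \<open>k\<close> is at most \<open>sqrt n\<close>, so
  \<open>(1 + k\<^sup>2) / (n + 1)\<close> tends to 0 although \<open>k\<close> tends to
  infinity.\<close>

definition partner :: "nat \<Rightarrow> nat" where
  "partner n = floor_sqrt (floor_sqrt n)"

lemma partner_le: "(real (partner n))\<^sup>2 \<le> sqrt (real n)"
proof -
  have "((partner n)\<^sup>2)\<^sup>2 \<le> n"
    unfolding partner_def
    using power_mono[of "(floor_sqrt (floor_sqrt n))\<^sup>2" "floor_sqrt n" 2] floor_sqrt_power2_le
      order_trans by fastforce
  then have "((real (partner n))\<^sup>2)\<^sup>2 \<le> real n"
    by (simp flip: of_nat_power)
  then show ?thesis by (rule real_le_rsqrt)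
qed

lemma partner_at_top: "filterlim partner at_top sequentially"
  unfolding filterlim_at_top
proof
  fix k
  show "\<forall>\<^sub>F n in sequentially. k \<le> partner n"
    by (rule eventually_sequentiallyI[of "(k\<^sup>2)\<^sup>2"]) (simp add: partner_def le_floor_sqrt_iff)
qed

lemma partner_pos: "n \<ge> 1 \<Longrightarrow> partner n \<ge> 1"
  by (simp add: partner_def Suc_le_eq)

section \<open>The two chaos components and the limits of their sum\<close>

definition Q1 :: "nat \<Rightarrow> (nat \<Rightarrow> real) \<Rightarrow> real" where
  "Q1 n \<omega> = 1 / sqrt (real n + 1) * X (Suc (2 * n)) \<omega>"

definition Q2 :: "nat \<Rightarrow> (nat \<Rightarrow> real) \<Rightarrow> real" where
  "Q2 n \<omega> = real (partner n) / sqrt (real n + 1) * (X (Suc (2 * n)) \<omega> * X (2 * partner n) \<omega>)"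

lemma measurable_Q [measurable]: "Q1 n \<in> borel_measurable \<Omega>" "Q2 n \<in> borel_measurable \<Omega>"
  unfolding Q1_def Q2_def by measurable

text \<open>The factored form isolates \<open>1 + k * X (2 * k)\<close>, which vanishes when
  \<open>X (2 * k)\<close> takes its low value \<open>-1/k\<close>.\<close>

lemma Q_sum: "Q1 n \<omega> + Q2 n \<omega> =
    X (Suc (2 * n)) \<omega> * (1 + real (partner n) * X (2 * partner n) \<omega>) / sqrt (real n + 1)"
  by (simp add: Q1_def Q2_def field_simps)

lemma odd_neq_even: "Suc (2 * n) \<noteq> 2 * k"
  by presburger

lemma Q_sum_second_moment:
  assumes "n \<ge> 1"
  shows "integrable \<Omega> (\<lambda>\<omega>. (Q1 n \<omega> + Q2 n \<omega>)\<^sup>2)"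
    and "(LINT \<omega>|\<Omega>. (Q1 n \<omega> + Q2 n \<omega>)\<^sup>2) = (1 + (real (partner n))\<^sup>2) / (real n + 1)"
proof -
  let ?k = "partner n"
  let ?h = "\<lambda>x. (1 + real ?k * x)\<^sup>2 / (real n + 1)"
  have eq: "(Q1 n \<omega> + Q2 n \<omega>)\<^sup>2 = (X (Suc (2 * n)) \<omega>)\<^sup>2 * ?h (X (2 * ?k) \<omega>)" for \<omega>
    unfolding Q_sum by (simp add: power_mult_distrib power_divide)
  show "integrable \<Omega> (\<lambda>\<omega>. (Q1 n \<omega> + Q2 n \<omega>)\<^sup>2)"
    unfolding eq by (rule product_moment) (auto simp: odd_neq_even)
  have k: "amplitude (2 * ?k) > 0"
    using partner_pos[OF assms] by (intro amplitude_pos) simp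
  have "(LINT \<omega>|\<Omega>. (Q1 n \<omega> + Q2 n \<omega>)\<^sup>2) = (LINT \<omega>|\<Omega>. ?h (X (2 * ?k) \<omega>))"
    unfolding eq using product_moment(2)[of "\<lambda>x. x\<^sup>2" ?h "Suc (2 * n)" "2 * ?k" amplitude]
    by (simp add: odd_neq_even two_point_variance)
  \<comment> \<open>Since \<open>k > 0\<close>, \<open>?h\<close> vanishes at the low value
    \<open>-1/k\<close>, and only the high value \<open>k\<close> contributes.\<close>
  also have "\<dots> = ?h (real ?k) * (1 / (1 + (real ?k)\<^sup>2))"
    using k integral_two_point[where h = ?h and s = amplitude and j = "2 * ?k"] by simp
  also have "\<dots> = (1 + (real ?k)\<^sup>2) / (real n + 1)"
  proof -
    have "1 + (real ?k)\<^sup>2 \<noteq> 0"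
      using zero_le_power2[of "real ?k"] by linarith
    then show ?thesis by (simp add: power2_eq_square)
  qed
  finally show "(LINT \<omega>|\<Omega>. (Q1 n \<omega> + Q2 n \<omega>)\<^sup>2) = (1 + (real ?k)\<^sup>2) / (real n + 1)" .
qed

lemma Q_sum_tendsto_L2: "tendsto_L2 \<Omega> (\<lambda>n \<omega>. Q1 n \<omega> + Q2 n \<omega>) (\<lambda>_. 0)"
proof -
  have "(\<lambda>n. (1 + (real (partner n))\<^sup>2) / (real n + 1)) \<longlonglongrightarrow> 0"
  proof (rule tendsto_sandwich[where f = "\<lambda>_. 0"])
    show "(\<lambda>n. (1 + sqrt (real n)) / (real n + 1)) \<longlonglongrightarrow> 0"
      by real_asymp
    show "\<forall>\<^sub>F n in sequentially.
        (1 + (real (partner n))\<^sup>2) / (real n + 1) \<le> (1 + sqrt (real n)) / (real n + 1)"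
      by (intro always_eventually allI divide_right_mono) (use partner_le in auto)
  qed auto
  then have "(\<lambda>n. LINT \<omega>|\<Omega>. (Q1 n \<omega> + Q2 n \<omega>)\<^sup>2) \<longlonglongrightarrow> 0"
    by (rule Lim_transform_eventually)
       (auto intro!: eventually_sequentiallyI[of 1] simp: Q_sum_second_moment)
  then show ?thesis
    by (auto simp: tendsto_L2_def Q_sum_second_moment)
qed

lemma Q_sum_tendsto_AE: "tendsto_AE \<Omega> (\<lambda>n \<omega>. Q1 n \<omega> + Q2 n \<omega>) (\<lambda>_. 0)"
  unfolding tendsto_AE_def
  using even_eventually_low
proof eventually_elim
  case (elim \<omega>)
  \<comment> \<open>\<open>partner\<close> stays constant on long stretches, but its divergence
    suffices to turn a property of all large \<open>k\<close> into one of all large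
    \<open>n\<close>.\<close>
  then have "\<forall>\<^sub>F n in sequentially. X (2 * partner n) \<omega> = - (1 / real (partner n))"
    using partner_at_top by (rule eventually_compose_filterlim)
  moreover have "\<forall>\<^sub>F n in sequentially. n \<ge> (1::nat)"
    by (rule eventually_ge_at_top)
  ultimately have "\<forall>\<^sub>F n in sequentially. Q1 n \<omega> + Q2 n \<omega> = 0"
  proof eventually_elim
    case (elim n)
    then show ?case
      using partner_pos[of n] by (simp add: Q_sum)
  qed
  then show ?case
    by (rule tendsto_eventually)
qed

lemma Q1_not_tendsto_AE: "\<not> tendsto_AE \<Omega> Q1 (\<lambda>_. 0)"
proof
  interpret prob_space \<Omega> by (rule prob_space_coins)
  assume "tendsto_AE \<Omega> Q1 (\<lambda>_. 0)"
  then have "AE \<omega> in \<Omega>. (\<lambda>n. Q1 n \<omega>) \<longlonglongrightarrow> 0"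
    by (simp add: tendsto_AE_def)
  with odd_not_eventually_low have "AE \<omega> in \<Omega>. False"
  proof eventually_elim
    case (elim \<omega>)
    \<comment> \<open>The high value of the odd variable makes \<open>Q1 n\<close> exactly 1, so
      convergence to 0 would exclude high values from some point on.\<close>
    from elim(2) have "\<forall>\<^sub>F n in sequentially. Q1 n \<omega> < 1"
      by (rule order_tendstoD) simp
    then have "\<forall>\<^sub>F n in sequentially. X (Suc (2 * n)) \<omega> \<noteq> sqrt (real n + 1)"
      by eventually_elim (auto simp: Q1_def)
    with elim(1) show False by contradiction
  qed
  then show False by simp
qed

section \<open>Realization of the components as first- and second-order chaoses\<close>

lemma is_chaos_Q1:
  "is_chaos \<Omega> X 1 (monomial_kernel (1 / sqrt (real n + 1)) [Suc (2 * n)]) (Q1 n)"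
proof -
  have "integrable \<Omega> (\<lambda>\<omega>. (1 / sqrt (real n + 1) * X (Suc (2 * n)) \<omega>)\<^sup>2)"
    by (rule integrable_two_point)
  then show ?thesis
    using is_chaos_monomial_kernel[of "[Suc (2 * n)]" "1 / sqrt (real n + 1)" X \<Omega>]
    by (simp add: Q1_def[abs_def])
qed

text \<open>The bound on \<open>n\<close> gives \<open>partner n \<ge> 1\<close>, so the index
  \<open>2 * partner n\<close> is not the excluded index 0; parity keeps the two indices
  distinct.\<close>

lemma is_chaos_Q2:
  assumes "n \<ge> 1"
  shows "is_chaos \<Omega> X 2
    (monomial_kernel (real (partner n) / sqrt (real n + 1)) [Suc (2 * n), 2 * partner n]) (Q2 n)"
proof -
  let ?c = "real (partner n) / sqrt (real n + 1)"
  \<comment> \<open>The constant is absorbed into the first factor, so that the integrand is a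
    product of functions of two independent variables.\<close>
  have "integrable \<Omega> (\<lambda>\<omega>. (?c * X (Suc (2 * n)) \<omega>)\<^sup>2 * (X (2 * partner n) \<omega>)\<^sup>2)"
    by (rule product_moment) (auto simp: odd_neq_even)
  then have "integrable \<Omega> (\<lambda>\<omega>. (?c * (X (Suc (2 * n)) \<omega> * X (2 * partner n) \<omega>))\<^sup>2)"
    by (simp only: power_mult_distrib mult.assoc)
  then show ?thesis
    using is_chaos_monomial_kernel[of "[Suc (2 * n), 2 * partner n]" ?c X \<Omega>] partner_pos[OF assms]
    by (simp add: Q2_def[abs_def] odd_neq_even numeral_2_eq_2[symmetric])
qed

theorem mainTheorem1:
  "\<exists>(M :: (nat \<Rightarrow> real) measure) (X :: nat \<Rightarrow> (nat \<Rightarrow> real) \<Rightarrow> real)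
     (f1 :: nat \<Rightarrow> nat list \<Rightarrow> real) (f2 :: nat \<Rightarrow> nat list \<Rightarrow> real)
     (Q1 :: nat \<Rightarrow> (nat \<Rightarrow> real) \<Rightarrow> real) (Q2 :: nat \<Rightarrow> (nat \<Rightarrow> real) \<Rightarrow> real).
     prob_space M \<and>
     prob_space.indep_vars M (\<lambda>_. borel) X {1..} \<and>
     (\<forall>n\<ge>1. \<exists>a b. a \<noteq> b \<and> X n ` space M = {a, b} \<and>
        measure M {\<omega> \<in> space M. X n \<omega> = a} > 0 \<and>
        measure M {\<omega> \<in> space M. X n \<omega> = b} > 0) \<and>
     (\<forall>n\<ge>1. (LINT \<omega>|M. X n \<omega>) = 0 \<and> (LINT \<omega>|M. (X n \<omega>)\<^sup>2) = 1) \<and>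
     (\<forall>n\<ge>1. f1 n \<in> kernels 1 \<and> f2 n \<in> kernels 2) \<and>
     (\<forall>n\<ge>1. is_chaos M X 1 (f1 n) (Q1 n) \<and> is_chaos M X 2 (f2 n) (Q2 n)) \<and>
     tendsto_AE M (\<lambda>n \<omega>. Q1 n \<omega> + Q2 n \<omega>) (\<lambda>_. 0) \<and>
     tendsto_L2 M (\<lambda>n \<omega>. Q1 n \<omega> + Q2 n \<omega>) (\<lambda>_. 0) \<and>
     \<not> tendsto_AE M Q1 (\<lambda>_. 0)"
proof (rule exI[of _ \<Omega>], rule exI[of _ X],
    rule exI[of _ "\<lambda>n. monomial_kernel (1 / sqrt (real n + 1)) [Suc (2 * n)]"],
    rule exI[of _ "\<lambda>n. monomial_kernel (real (partner n) / sqrt (real n + 1))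
      [Suc (2 * n), 2 * partner n]"],
    rule exI[of _ Q1], rule exI[of _ Q2], intro conjI allI impI)
  show "prob_space \<Omega>" by (rule prob_space_coins)
  show "prob_space.indep_vars \<Omega> (\<lambda>_. borel) X {1..}" by (rule indep_vars_two_point)
next
  fix n :: nat assume "n \<ge> 1"
  then show "\<exists>a b. a \<noteq> b \<and> X n ` space \<Omega> = {a, b} \<and>
      measure \<Omega> {\<omega> \<in> space \<Omega>. X n \<omega> = a} > 0 \<and> measure \<Omega> {\<omega> \<in> space \<Omega>. X n \<omega> = b} > 0"
    by (intro two_point_two_valued amplitude_pos)
next
  fix n :: nat assume "n \<ge> 1"
  then show "(LINT \<omega>|\<Omega>. X n \<omega>) = 0" "(LINT \<omega>|\<Omega>. (X n \<omega>)\<^sup>2) = 1"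
    by (simp_all add: two_point_mean two_point_variance amplitude_pos)
next
  fix n :: nat assume n: "n \<ge> 1"
  show "monomial_kernel (1 / sqrt (real n + 1)) [Suc (2 * n)] \<in> kernels 1"
    using monomial_kernel_in_kernels[of "[Suc (2 * n)]"] by simp
  show "monomial_kernel (real (partner n) / sqrt (real n + 1)) [Suc (2 * n), 2 * partner n] \<in> kernels 2"
    using monomial_kernel_in_kernels[of "[Suc (2 * n), 2 * partner n]"]
    by (simp add: odd_neq_even numeral_2_eq_2[symmetric])
  show "is_chaos \<Omega> X 1 (monomial_kernel (1 / sqrt (real n + 1)) [Suc (2 * n)]) (Q1 n)"
    by (rule is_chaos_Q1)
  show "is_chaos \<Omega> X 2
      (monomial_kernel (real (partner n) / sqrt (real n + 1)) [Suc (2 * n), 2 * partner n]) (Q2 n)"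
    using n by (rule is_chaos_Q2)
qed (rule Q_sum_tendsto_AE Q_sum_tendsto_L2 Q1_not_tendsto_AE)+

end
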